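(* The stochastic integral $\mathcal{I}$ extends to square-integrable predictable processes $U$ via the (conditional) isometry formula: for all $n\in\mathbb{N}$, $$\mathbb{E}\big[|\mathcal{I}(1_{[n,\infty)}U)|^2\,\big|\,\mathcal{F}_{n-1}\big]=\mathbb{E}\big[\|1_{[n,\infty)}U\|^2\,\big|\,\mathcal{F}_{n-1}\big],$$ where $1_{[n,\infty)}U$ denotes the process $(0,\dots,0,U_n,U_{n+1},\dots)$.
   Context: $Y=(Y_n)_{n\in\mathbb{N}}$, $Y_n=(Y_n^1,\dots,Y_n^d)$ ($0\in\mathbb{N}$), is an $\mathbb{R}^d$-valued process on a probability space $(\Omega,\mathcal{F},\mathbb{P})$, $\mathcal{F}_n=\sigma(Y_0,\dots,Y_n)$, $\mathcal{F}_{-1}=\{\varnothing,\Omega\}$, with $\mathbb{E}[Y_n^i\,|\,\mathcal{F}_{n-1}]=0$ and $\mathbb{E}[Y_n^iY_n^j\,|\,\mathcal{F}_{n-1}]=\delta^{ij}$ for all $n\ge0$, $1\le i,j\le d$. A process $U=(U_n)_{n\in\mathbb{N}}$ is predictable if $U_n$ is $\mathcal{F}_{n-1}$-measurable for each $n$. For a uniformly bounded sequence $U$ of $\mathbb{R}^d$-valued random variables with finite support in $\mathbb{N}$ ($U_n=0$ for all but finitely many $n$), the stochastic integral is $\mathcal{I}(U)=\sum_{n=0}^\infty\langle U_n,Y_n\rangle$, with $\langle\cdot,\cdot\rangle$ the Euclidean inner product. For a process $U$, $\|U\|^2=\sum_{n\ge0}\|U_n\|_{\mathbb{R}^d}^2$,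 and $U$ is square-integrable if $\mathbb{E}[\|U\|^2]<\infty$. The extension is by $L^2$-limits from bounded predictable processes with finite support. *)

theory Defs
  imports "HOL-Probability.Probability"
begin

text \<open>The sigma-algebra generated by \<open>Y\<^sub>0, \<dots>, Y\<^sub>n\<^sub>-\<^sub>1\<close>. In the usual notation
  \<open>\<F>\<^sub>n = \<sigma>(Y\<^sub>0, \<dots>, Y\<^sub>n)\<close>, this is \<open>\<F>\<^sub>n\<^sub>-\<^sub>1\<close>; the index is shifted by one so that
  the trivial \<open>\<F>\<^sub>-\<^sub>1\<close> is the case \<open>n = 0\<close>.\<close>

definition past_algebra ::
    "'a measure \<Rightarrow> (nat \<Rightarrow> 'a \<Rightarrow> 'b::topological_space) \<Rightarrow> nat \<Rightarrow> 'a measure" where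
  "past_algebra M Y n =
     sigma (space M) {Y k -` A \<inter> space M | k A. k < n \<and> A \<in> sets borel}"

lemma sets_past_algebra_0: "sets (past_algebra M Y 0) = {{}, space M}"
  by (simp add: past_algebra_def sigma_sets_empty_eq)

definition predictable ::
    "'a measure \<Rightarrow> (nat \<Rightarrow> 'a \<Rightarrow> 'b::topological_space) \<Rightarrow>
     (nat \<Rightarrow> 'a \<Rightarrow> 'c::topological_space) \<Rightarrow> bool" where
  "predictable M Y U \<longleftrightarrow> (\<forall>n. U n \<in> borel_measurable (past_algebra M Y n))"

definition sq_norm :: "(nat \<Rightarrow> 'a \<Rightarrow> 'c::real_normed_vector) \<Rightarrow> 'a \<Rightarrow> ennreal" where
  "sq_norm U \<omega> = (\<Sum>n. ennreal ((norm (U n \<omega>))\<^sup>2))"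

definition square_integrable ::
    "'a measure \<Rightarrow> (nat \<Rightarrow> 'a \<Rightarrow> 'c::real_normed_vector) \<Rightarrow> bool" where
  "square_integrable M U \<longleftrightarrow> (\<integral>\<^sup>+\<omega>. sq_norm U \<omega> \<partial>M) < \<infinity>"

definition elementary_predictable ::
    "'a measure \<Rightarrow> (nat \<Rightarrow> 'a \<Rightarrow> 'b::topological_space) \<Rightarrow>
     (nat \<Rightarrow> 'a \<Rightarrow> 'c::real_normed_vector) \<Rightarrow> bool" where
  "elementary_predictable M Y U \<longleftrightarrow>
     predictable M Y U \<and>
     (\<exists>C. \<forall>n. \<forall>\<omega>\<in>space M. norm (U n \<omega>) \<le> C) \<and>
     finite {n. \<exists>\<omega>\<in>space M. U n \<omega> \<noteq> 0}"

definition elementary_integral ::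
    "(nat \<Rightarrow> 'a \<Rightarrow> 'b::real_inner) \<Rightarrow> (nat \<Rightarrow> 'a \<Rightarrow> 'b) \<Rightarrow> 'a \<Rightarrow> real" where
  "elementary_integral Y U \<omega> = (\<Sum>n. U n \<omega> \<bullet> Y n \<omega>)"

definition approximates ::
    "'a measure \<Rightarrow> (nat \<Rightarrow> 'a \<Rightarrow> 'b::real_inner) \<Rightarrow>
     (nat \<Rightarrow> nat \<Rightarrow> 'a \<Rightarrow> 'b) \<Rightarrow> (nat \<Rightarrow> 'a \<Rightarrow> 'b) \<Rightarrow> bool" where
  "approximates M Y V U \<longleftrightarrow>
     (\<forall>k. elementary_predictable M Y (V k)) \<and>
     (\<lambda>k. \<integral>\<^sup>+\<omega>. sq_norm (\<lambda>n \<omega>. V k n \<omega> - U n \<omega>) \<omega> \<partial>M) \<longlonglongrightarrow> 0"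

definition L2_converges ::
    "'a measure \<Rightarrow> (nat \<Rightarrow> 'a \<Rightarrow> real) \<Rightarrow> ('a \<Rightarrow> real) \<Rightarrow> bool" where
  "L2_converges M Z X \<longleftrightarrow> (\<lambda>k. \<integral>\<^sup>+\<omega>. ennreal ((Z k \<omega> - X \<omega>)\<^sup>2) \<partial>M) \<longlonglongrightarrow> 0"

definition is_stochastic_integral ::
    "'a measure \<Rightarrow> (nat \<Rightarrow> 'a \<Rightarrow> 'b::real_inner) \<Rightarrow> (nat \<Rightarrow> 'a \<Rightarrow> 'b) \<Rightarrow>
     ('a \<Rightarrow> real) \<Rightarrow> bool" where
  "is_stochastic_integral M Y U X \<longleftrightarrow>
     X \<in> borel_measurable M \<and> integrable M (\<lambda>\<omega>. (X \<omega>)\<^sup>2) \<and>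
     (\<exists>V. approximates M Y V U \<and> L2_converges M (\<lambda>k. elementary_integral Y (V k)) X)"

text \<open>The integral is only determined almost surely, so the operator picks a version.\<close>

definition stochastic_integral ::
    "'a measure \<Rightarrow> (nat \<Rightarrow> 'a \<Rightarrow> 'b::real_inner) \<Rightarrow> (nat \<Rightarrow> 'a \<Rightarrow> 'b) \<Rightarrow> 'a \<Rightarrow> real" where
  "stochastic_integral M Y U = (SOME X. is_stochastic_integral M Y U X)"

definition tail_process ::
    "nat \<Rightarrow> (nat \<Rightarrow> 'a \<Rightarrow> 'c::zero) \<Rightarrow> nat \<Rightarrow> 'a \<Rightarrow> 'c" where
  "tail_process n U k \<omega> = (if n \<le> k then U k \<omega> else 0)"

end

theory Submission
  imports Defs
begin

text \<open>The increments \<open>\<langle>V\<^sub>n, Y\<^sub>n\<rangle>\<close> of an elementary integral are orthogonal: given the past before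
  time \<open>n\<close>, both \<open>V\<^sub>n\<close> and the partial sum \<open>S\<^sub>n = \<Sum>\<^sub>k\<^sub><\<^sub>n \<langle>V\<^sub>k, Y\<^sub>k\<rangle>\<close> are known, so the cross term
  \<open>S\<^sub>n\<langle>V\<^sub>n, Y\<^sub>n\<rangle>\<close> has mean zero, while \<open>\<langle>V\<^sub>n, Y\<^sub>n\<rangle>\<^sup>2\<close> averages to \<open>\<parallel>V\<^sub>n\<parallel>\<^sup>2\<close> because the conditional
  covariance of \<open>Y\<^sub>n\<close> is the identity. Adding up the increments gives the isometry
  \<open>E[I(V)\<^sup>2] = E[\<parallel>V\<parallel>\<^sup>2]\<close> for elementary \<open>V\<close> (\<open>isometry_step\<close>, \<open>elementary_isometry\<close>).

  Cutting off a square-integrable predictable process at a large time and wherever its norm is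
  large approximates it in mean square by elementary processes (\<open>exists_approximation\<close>). By the
  isometry their integrals form an \<open>L\<^sup>2\<close>-Cauchy sequence, hence converge (\<open>L2_complete\<close>), and two
  approximations of the same process have integrals with vanishing \<open>L\<^sup>2\<close>-distance, so the limit is
  the same for all of them. The isometry survives the passage to the limit
  (\<open>L2_limit_isometry\<close>).

  The conditional isometry at time \<open>n\<close> is the unconditional one in disguise. If \<open>A\<close> is an event of
  the past before \<open>n\<close>, then the process \<open>1\<^sub>A 1\<^sub>[\<^sub>n\<^sub>,\<^sub>\<infinity>\<^sub>)U\<close> is again predictable, because it vanishes
  until \<open>A\<close> is decided, and its integral is \<open>1\<^sub>A I(1\<^sub>[\<^sub>n\<^sub>,\<^sub>\<infinity>\<^sub>)U)\<close>. The isometry for this process says that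
  \<open>I(1\<^sub>[\<^sub>n\<^sub>,\<^sub>\<infinity>\<^sub>)U)\<^sup>2\<close> and \<open>\<parallel>1\<^sub>[\<^sub>n\<^sub>,\<^sub>\<infinity>\<^sub>)U\<parallel>\<^sup>2\<close> have the same integral over every such \<open>A\<close>, and this
  characterises equality of the conditional expectations (\<open>restricted_isometry\<close>,
  \<open>conditional_isometry\<close>).\<close>

section \<open>Limits of mean squares\<close>

text \<open>Expand the square and apply the weighted AM-GM inequality to the mixed term. This replaces
  Minkowski's inequality below: it is linear in the squares, so it can be integrated as it stands
  in the extended nonnegative reals, where integrals may be infinite and square roots are awkward.
  With \<open>e = 1\<close> it serves as a triangle inequality; to compare norms, \<open>e\<close> is sent to \<open>0\<close>, so that the
  constant in front of the main term tends to \<open>1\<close>.\<close>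

lemma power2_norm_add_le:
  fixes x y :: "'a::real_normed_vector"
  assumes "0 < e"
  shows "(norm (x + y))\<^sup>2 \<le> (1 + e) * (norm x)\<^sup>2 + (1 + 1/e) * (norm y)\<^sup>2"
proof -
  have "0 \<le> (e * norm x - norm y)\<^sup>2 / e" using assms by simp
  also have "\<dots> = e * (norm x)\<^sup>2 + (norm y)\<^sup>2 / e - 2 * norm x * norm y"
    using assms by (simp add: field_simps power2_eq_square)
  finally have "(norm x + norm y)\<^sup>2 \<le> (1 + e) * (norm x)\<^sup>2 + (1 + 1/e) * (norm y)\<^sup>2"
    by (simp add: power2_sum algebra_simps)
  moreover have "(norm (x + y))\<^sup>2 \<le> (norm x + norm y)\<^sup>2"
    by (intro power_mono norm_triangle_ineq) simp
  ultimately show ?thesis by linarith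
qed

lemma power2_norm_perturb:
  fixes x y :: "'a::real_normed_vector"
  assumes "0 < e"
  shows "ennreal ((norm x)\<^sup>2) \<le>
    ennreal (1 + e) * ennreal ((norm y)\<^sup>2) + ennreal (1 + 1/e) * ennreal ((norm (x - y))\<^sup>2)"
proof -
  have "(norm x)\<^sup>2 \<le> (1 + e) * (norm y)\<^sup>2 + (1 + 1/e) * (norm (x - y))\<^sup>2"
    using power2_norm_add_le[OF assms, of y "x - y"] by simp
  then show ?thesis
    using assms by (simp flip: ennreal_mult ennreal_plus)
qed

lemma sq_norm_perturb:
  fixes U V :: "nat \<Rightarrow> 'a \<Rightarrow> 'c::real_normed_vector"
  assumes "0 < e"
  shows "sq_norm U \<omega> \<le>
    ennreal (1 + e) * sq_norm V \<omega> + ennreal (1 + 1/e) * sq_norm (\<lambda>n \<omega>. U n \<omega> - V n \<omega>) \<omega>"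
proof -
  have "sq_norm U \<omega> \<le> (\<Sum>n. ennreal (1 + e) * ennreal ((norm (V n \<omega>))\<^sup>2)
      + ennreal (1 + 1/e) * ennreal ((norm (U n \<omega> - V n \<omega>))\<^sup>2))"
    unfolding sq_norm_def by (intro suminf_le power2_norm_perturb assms summableI)
  also have "\<dots> = ennreal (1 + e) * sq_norm V \<omega>
      + ennreal (1 + 1/e) * sq_norm (\<lambda>n \<omega>. U n \<omega> - V n \<omega>) \<omega>"
    unfolding sq_norm_def by (subst suminf_add[symmetric]) (auto intro: summableI)
  finally show ?thesis .
qed

lemma sq_norm_minus_commute:
  "sq_norm (\<lambda>n \<omega>. U n \<omega> - V n \<omega>) = sq_norm (\<lambda>n \<omega>. V n \<omega> - U n \<omega>)"
  by (simp add: sq_norm_def fun_eq_iff norm_minus_commute)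

lemma measurable_sq_norm:
  fixes U :: "nat \<Rightarrow> 'a \<Rightarrow> 'c::real_normed_vector"
  assumes [measurable]: "\<And>n. U n \<in> borel_measurable M"
  shows "sq_norm U \<in> borel_measurable M"
  unfolding sq_norm_def by measurable

lemma nn_integral_sq_norm_perturb:
  fixes U V :: "nat \<Rightarrow> 'a \<Rightarrow> 'c::{real_normed_vector, second_countable_topology}"
  assumes "0 < e" and [measurable]: "\<And>n. U n \<in> borel_measurable M" "\<And>n. V n \<in> borel_measurable M"
  shows "(\<integral>\<^sup>+\<omega>. sq_norm U \<omega> \<partial>M) \<le> ennreal (1 + e) * (\<integral>\<^sup>+\<omega>. sq_norm V \<omega> \<partial>M)
    + ennreal (1 + 1/e) * (\<integral>\<^sup>+\<omega>. sq_norm (\<lambda>n \<omega>. U n \<omega> - V n \<omega>) \<omega> \<partial>M)"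
proof -
  note [measurable] = measurable_sq_norm
  have "(\<integral>\<^sup>+\<omega>. sq_norm U \<omega> \<partial>M) \<le> (\<integral>\<^sup>+\<omega>. ennreal (1 + e) * sq_norm V \<omega>
      + ennreal (1 + 1/e) * sq_norm (\<lambda>n \<omega>. U n \<omega> - V n \<omega>) \<omega> \<partial>M)"
    by (intro nn_integral_mono sq_norm_perturb assms)
  also have "\<dots> = ennreal (1 + e) * (\<integral>\<^sup>+\<omega>. sq_norm V \<omega> \<partial>M)
    + ennreal (1 + 1/e) * (\<integral>\<^sup>+\<omega>. sq_norm (\<lambda>n \<omega>. U n \<omega> - V n \<omega>) \<omega> \<partial>M)"
    by (simp add: nn_integral_add nn_integral_cmult)
  finally show ?thesis .
qed

lemma nn_integral_power2_perturb:
  fixes f g :: "'a \<Rightarrow> real"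
  assumes "0 < e" and [measurable]: "f \<in> borel_measurable M" "g \<in> borel_measurable M"
  shows "(\<integral>\<^sup>+\<omega>. ennreal ((f \<omega>)\<^sup>2) \<partial>M) \<le> ennreal (1 + e) * (\<integral>\<^sup>+\<omega>. ennreal ((g \<omega>)\<^sup>2) \<partial>M)
    + ennreal (1 + 1/e) * (\<integral>\<^sup>+\<omega>. ennreal ((f \<omega> - g \<omega>)\<^sup>2) \<partial>M)"
proof -
  have "(\<integral>\<^sup>+\<omega>. ennreal ((f \<omega>)\<^sup>2) \<partial>M) \<le> (\<integral>\<^sup>+\<omega>. ennreal (1 + e) * ennreal ((g \<omega>)\<^sup>2)
      + ennreal (1 + 1/e) * ennreal ((f \<omega> - g \<omega>)\<^sup>2) \<partial>M)"
    using power2_norm_perturb[OF assms(1), of "f _" "g _"] by (intro nn_integral_mono) simp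
  also have "\<dots> = ennreal (1 + e) * (\<integral>\<^sup>+\<omega>. ennreal ((g \<omega>)\<^sup>2) \<partial>M)
    + ennreal (1 + 1/e) * (\<integral>\<^sup>+\<omega>. ennreal ((f \<omega> - g \<omega>)\<^sup>2) \<partial>M)"
    by (simp add: nn_integral_add nn_integral_cmult)
  finally show ?thesis .
qed

lemma nn_integral_power2_minus_commute:
  fixes f g :: "'a \<Rightarrow> real"
  shows "(\<integral>\<^sup>+\<omega>. ennreal ((f \<omega> - g \<omega>)\<^sup>2) \<partial>M) = (\<integral>\<^sup>+\<omega>. ennreal ((g \<omega> - f \<omega>)\<^sup>2) \<partial>M)"
  by (simp add: power2_commute)

lemma nn_integral_power2_triangle:
  fixes f g h :: "'a \<Rightarrow> real"
  assumes [measurable]: "f \<in> borel_measurable M" "g \<in> borel_measurable M" "h \<in> borel_measurable M"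
  shows "(\<integral>\<^sup>+\<omega>. ennreal ((f \<omega> - h \<omega>)\<^sup>2) \<partial>M) \<le>
    2 * (\<integral>\<^sup>+\<omega>. ennreal ((f \<omega> - g \<omega>)\<^sup>2) \<partial>M) + 2 * (\<integral>\<^sup>+\<omega>. ennreal ((g \<omega> - h \<omega>)\<^sup>2) \<partial>M)"
  using nn_integral_power2_perturb[of 1 "\<lambda>\<omega>. f \<omega> - h \<omega>" M "\<lambda>\<omega>. f \<omega> - g \<omega>"] by simp

text \<open>This is continuity of the norm, stated for squared norms. Think of \<open>x\<close>, \<open>a k\<close> and \<open>s\<close> as
  squared norms of elements whose squared distances are \<open>c k\<close> (from the first to the second) and
  \<open>d k\<close> (from the second to the third); the three elements may live in different spaces as long as
  the middle one has the same norm in both. The limit \<open>k \<rightarrow> \<infinity>\<close> for fixed \<open>e\<close> yields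
  \<open>x \<le> (1 + e)\<^sup>2 s\<close>, and then \<open>e\<close> tends to \<open>0\<close>.\<close>

lemma le_of_mean_square_limits:
  fixes x s :: ennreal
  assumes x: "\<And>k e. 0 < e \<Longrightarrow> x \<le> ennreal (1 + e) * a k + ennreal (1 + 1/e) * c k"
    and s: "\<And>k e. 0 < e \<Longrightarrow> a k \<le> ennreal (1 + e) * s + ennreal (1 + 1/e) * d k"
    and c: "c \<longlonglongrightarrow> 0" and d: "d \<longlonglongrightarrow> 0"
  shows "x \<le> s"
proof (cases s)
  case top then show ?thesis by simp
next
  case (real r)
  have le: "x \<le> ennreal ((1 + e) * (1 + e) * r)" if e: "0 < e" for e :: real
  proof -
    have "(\<lambda>k. ennreal (1 + e) * (ennreal (1 + e) * s + ennreal (1 + 1/e) * d k) + ennreal (1 + 1/e) * c k)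
        \<longlonglongrightarrow> ennreal (1 + e) * (ennreal (1 + e) * s + ennreal (1 + 1/e) * 0) + ennreal (1 + 1/e) * 0"
      by (intro tendsto_add ennreal_tendsto_cmult tendsto_const c d) simp_all
    moreover have "x \<le> ennreal (1 + e) * (ennreal (1 + e) * s + ennreal (1 + 1/e) * d k) + ennreal (1 + 1/e) * c k" for k
      using x[OF e, of k] s[OF e, of k] by (meson add_right_mono mult_left_mono order_trans zero_le)
    ultimately have "x \<le> ennreal (1 + e) * (ennreal (1 + e) * s + ennreal (1 + 1/e) * 0) + ennreal (1 + 1/e) * 0"
      by (intro LIMSEQ_le_const) auto
    then show ?thesis using e real by (simp add: mult.assoc ennreal_mult del: ennreal_plus)
  qed
  have "(\<lambda>n. ennreal ((1 + 1 / real (Suc n)) * (1 + 1 / real (Suc n)) * r)) \<longlonglongrightarrow> ennreal ((1 + 0) * (1 + 0) * r)"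
    by (intro tendsto_ennrealI tendsto_intros LIMSEQ_Suc[OF lim_1_over_n])
  then have "x \<le> ennreal ((1 + 0) * (1 + 0) * r)"
    by (rule LIMSEQ_le_const) (auto intro!: le)
  then show ?thesis using real by simp
qed

section \<open>Mean square convergence\<close>

lemma L2_converges_transfer:
  assumes [measurable]: "\<And>k. Z k \<in> borel_measurable M" "\<And>k. W k \<in> borel_measurable M" "X \<in> borel_measurable M"
    and Z: "L2_converges M Z X"
    and a: "a \<longlonglongrightarrow> 0" "\<And>k. (\<integral>\<^sup>+\<omega>. ennreal ((W k \<omega> - Z k \<omega>)\<^sup>2) \<partial>M) \<le> a k"
  shows "L2_converges M W X"
  unfolding L2_converges_def
proof (rule tendsto_sandwich[OF _ _ tendsto_const])
  show "\<forall>\<^sub>F k in sequentially. (\<integral>\<^sup>+\<omega>. ennreal ((W k \<omega> - X \<omega>)\<^sup>2) \<partial>M)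
      \<le> 2 * a k + 2 * (\<integral>\<^sup>+\<omega>. ennreal ((Z k \<omega> - X \<omega>)\<^sup>2) \<partial>M)"
  proof (intro always_eventually allI)
    fix k
    show "(\<integral>\<^sup>+\<omega>. ennreal ((W k \<omega> - X \<omega>)\<^sup>2) \<partial>M)
        \<le> 2 * a k + 2 * (\<integral>\<^sup>+\<omega>. ennreal ((Z k \<omega> - X \<omega>)\<^sup>2) \<partial>M)"
      by (rule order_trans[OF nn_integral_power2_triangle[of _ _ "Z k"]])
         (auto intro!: add_right_mono mult_left_mono a)
  qed
  have "(\<lambda>k. 2 * a k + 2 * (\<integral>\<^sup>+\<omega>. ennreal ((Z k \<omega> - X \<omega>)\<^sup>2) \<partial>M)) \<longlonglongrightarrow> 2 * 0 + 2 * 0"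
    using Z a(1) unfolding L2_converges_def by (intro tendsto_add ennreal_tendsto_cmult) simp_all
  then show "(\<lambda>k. 2 * a k + 2 * (\<integral>\<^sup>+\<omega>. ennreal ((Z k \<omega> - X \<omega>)\<^sup>2) \<partial>M)) \<longlonglongrightarrow> 0" by simp
qed simp

lemma L2_converges_const_AE_eq:
  assumes [measurable]: "Z \<in> borel_measurable M" "X \<in> borel_measurable M"
    and "L2_converges M (\<lambda>k. Z) X"
  shows "AE \<omega> in M. X \<omega> = Z \<omega>"
proof -
  have "(\<integral>\<^sup>+\<omega>. ennreal ((Z \<omega> - X \<omega>)\<^sup>2) \<partial>M) = 0"
    using assms(3) by (simp add: L2_converges_def LIMSEQ_const_iff)
  then have "AE \<omega> in M. ennreal ((Z \<omega> - X \<omega>)\<^sup>2) = 0"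
    by (subst (asm) nn_integral_0_iff_AE) simp_all
  then show ?thesis by eventually_elim (simp add: ennreal_eq_0_iff)
qed

lemma L2_converges_indicator:
  assumes "L2_converges M Z X"
  shows "L2_converges M (\<lambda>k \<omega>. indicator A \<omega> * Z k \<omega>) (\<lambda>\<omega>. indicator A \<omega> * X \<omega>)"
  using assms unfolding L2_converges_def
  by (rule tendsto_sandwich[OF _ _ tendsto_const, rotated 2])
     (auto intro!: always_eventually nn_integral_mono simp: indicator_def)

text \<open>The difference of the two sides is the variance of \<open>\<bar>f\<bar>\<close>.\<close>

lemma (in prob_space) expectation_abs_power2_le:
  fixes f :: "'a \<Rightarrow> real"
  assumes [measurable]: "f \<in> borel_measurable M" and f2: "integrable M (\<lambda>x. (f x)\<^sup>2)"
  shows "(expectation (\<lambda>x. \<bar>f x\<bar>))\<^sup>2 \<le> expectation (\<lambda>x. (f x)\<^sup>2)"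
proof -
  have "integrable M f" using f2 by (auto intro: square_integrable_imp_integrable)
  then have "variance (\<lambda>x. \<bar>f x\<bar>) = expectation (\<lambda>x. \<bar>f x\<bar>\<^sup>2) - (expectation (\<lambda>x. \<bar>f x\<bar>))\<^sup>2"
    using f2 by (intro variance_eq) simp_all
  with variance_positive[of "\<lambda>x. \<bar>f x\<bar>"] show ?thesis by simp
qed

lemma integrable_power2_iff:
  fixes f :: "'a \<Rightarrow> real"
  assumes [measurable]: "f \<in> borel_measurable M"
  shows "integrable M (\<lambda>x. (f x)\<^sup>2) \<longleftrightarrow> (\<integral>\<^sup>+x. ennreal ((f x)\<^sup>2) \<partial>M) < \<infinity>"
  by (simp add: integrable_iff_bounded)

text \<open>The Riesz--Fischer argument. The \<open>L\<^sup>1\<close>-norm is dominated by the \<open>L\<^sup>2\<close>-norm, so the sequence is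
  \<open>L\<^sup>1\<close>-Cauchy and a subsequence converges almost surely; Fatou's lemma along it bounds
  the \<open>L\<^sup>2\<close>-distance to the limit. The Cauchy condition has the form in which it arises for
  elementary integrals: the distance of two members is bounded by the sum of their distances to a
  common limit in another space.\<close>

lemma (in prob_space) L2_complete:
  fixes Z :: "nat \<Rightarrow> 'a \<Rightarrow> real"
  assumes Z [measurable]: "\<And>k. Z k \<in> borel_measurable M"
    and Z2: "\<And>k. integrable M (\<lambda>\<omega>. (Z k \<omega>)\<^sup>2)"
    and a: "a \<longlonglongrightarrow> 0"
    and le: "\<And>i j. (\<integral>\<^sup>+\<omega>. ennreal ((Z i \<omega> - Z j \<omega>)\<^sup>2) \<partial>M) \<le> a i + a j"
  obtains X where "X \<in> borel_measurable M" "integrable M (\<lambda>\<omega>. (X \<omega>)\<^sup>2)" "L2_converges M Z X"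
proof -
  have Zint: "integrable M (Z k)" for k
    by (rule square_integrable_imp_integrable[OF Z Z2])
  have D2: "integrable M (\<lambda>\<omega>. (Z i \<omega> - Z j \<omega>)\<^sup>2)" for i j
  proof -
    have "(\<integral>\<^sup>+\<omega>. ennreal ((Z i \<omega> - Z j \<omega>)\<^sup>2) \<partial>M) \<le>
        2 * (\<integral>\<^sup>+\<omega>. ennreal ((Z i \<omega>)\<^sup>2) \<partial>M) + 2 * (\<integral>\<^sup>+\<omega>. ennreal ((Z j \<omega>)\<^sup>2) \<partial>M)"
      using nn_integral_power2_triangle[of "Z i" M "\<lambda>_. 0" "Z j"] by simp
    also have "\<dots> < \<infinity>" using Z2 by (simp add: integrable_power2_iff ennreal_mult_less_top)
    finally show ?thesis by (simp add: integrable_power2_iff)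
  qed
  have "\<exists>N. \<forall>i\<ge>N. \<forall>j\<ge>N. (LINT x|M. norm (Z i x - Z j x)) < e" if "0 < e" for e
  proof -
    have "\<forall>\<^sub>F k in sequentially. a k < ennreal (e\<^sup>2 / 2)"
      using that by (intro order_tendstoD(2)[OF a]) (auto simp: ennreal_less_zero_iff)
    then obtain N where N: "\<And>k. N \<le> k \<Longrightarrow> a k < ennreal (e\<^sup>2 / 2)"
      by (auto simp: eventually_sequentially)
    have "(LINT x|M. norm (Z i x - Z j x)) < e" if "N \<le> i" "N \<le> j" for i j
    proof -
      have "ennreal (LINT x|M. (Z i x - Z j x)\<^sup>2) = (\<integral>\<^sup>+\<omega>. ennreal ((Z i \<omega> - Z j \<omega>)\<^sup>2) \<partial>M)"
        by (simp add: nn_integral_eq_integral D2)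
      also have "\<dots> < ennreal (e\<^sup>2 / 2) + ennreal (e\<^sup>2 / 2)"
        using le N that by (meson add_strict_mono order_le_less_trans)
      also have "\<dots> = ennreal (e\<^sup>2)" by (simp flip: ennreal_plus)
      finally have "(LINT x|M. (Z i x - Z j x)\<^sup>2) < e\<^sup>2"
        by (simp add: ennreal_less_iff)
      with expectation_abs_power2_le[OF _ D2, of i j] have "(LINT x|M. norm (Z i x - Z j x))\<^sup>2 < e\<^sup>2"
        by simp
      then show ?thesis using \<open>0 < e\<close> by (auto intro: power2_less_imp_less)
    qed
    then show ?thesis by auto
  qed
  from cauchy_L1_AE_cauchy_subseq[OF Zint this] obtain r where
    r: "strict_mono r" "AE \<omega> in M. Cauchy (\<lambda>i. Z (r i) \<omega>)" by blast
  define X where "X = (\<lambda>\<omega>. lim (\<lambda>i. Z (r i) \<omega>))"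
  have X [measurable]: "X \<in> borel_measurable M" unfolding X_def by measurable
  have lim: "AE \<omega> in M. (\<lambda>i. Z (r i) \<omega>) \<longlonglongrightarrow> X \<omega>"
    using r(2) by eventually_elim (simp add: X_def convergent_LIMSEQ_iff[symmetric] Cauchy_convergent_iff)
  have bound: "(\<integral>\<^sup>+\<omega>. ennreal ((Z k \<omega> - X \<omega>)\<^sup>2) \<partial>M) \<le> a k" for k
  proof -
    have "AE \<omega> in M. ennreal ((Z k \<omega> - X \<omega>)\<^sup>2) = liminf (\<lambda>i. ennreal ((Z k \<omega> - Z (r i) \<omega>)\<^sup>2))"
      using lim
    proof eventually_elim
      case (elim \<omega>)
      then have "(\<lambda>i. ennreal ((Z k \<omega> - Z (r i) \<omega>)\<^sup>2)) \<longlonglongrightarrow> ennreal ((Z k \<omega> - X \<omega>)\<^sup>2)"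
        by (intro tendsto_intros tendsto_ennrealI)
      then show ?case by (intro lim_imp_Liminf[symmetric]) simp_all
    qed
    then have "(\<integral>\<^sup>+\<omega>. ennreal ((Z k \<omega> - X \<omega>)\<^sup>2) \<partial>M)
        = (\<integral>\<^sup>+\<omega>. liminf (\<lambda>i. ennreal ((Z k \<omega> - Z (r i) \<omega>)\<^sup>2)) \<partial>M)"
      by (rule nn_integral_cong_AE)
    also have "\<dots> \<le> liminf (\<lambda>i. \<integral>\<^sup>+\<omega>. ennreal ((Z k \<omega> - Z (r i) \<omega>)\<^sup>2) \<partial>M)"
      by (intro nn_integral_liminf) simp
    also have "\<dots> \<le> liminf (\<lambda>i. a k + a (r i))"
      by (intro Liminf_mono always_eventually allI le)
    also have "\<dots> = a k"
    proof (intro lim_imp_Liminf)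
      have "(\<lambda>i. a k + a (r i)) \<longlonglongrightarrow> a k + 0"
        by (intro tendsto_intros LIMSEQ_subseq_LIMSEQ[OF a r(1), unfolded o_def])
      then show "(\<lambda>i. a k + a (r i)) \<longlonglongrightarrow> a k" by simp
    qed simp
    finally show ?thesis .
  qed
  have conv: "L2_converges M Z X"
    unfolding L2_converges_def
    by (rule tendsto_sandwich[OF _ _ tendsto_const a]) (simp_all add: bound)
  have "\<forall>\<^sub>F k in sequentially. a k < 1" by (intro order_tendstoD(2)[OF a]) simp
  then obtain k where k: "a k < 1" by (auto simp: eventually_sequentially)
  have "(\<integral>\<^sup>+\<omega>. ennreal ((X \<omega>)\<^sup>2) \<partial>M) \<le> 2 * (\<integral>\<^sup>+\<omega>. ennreal ((X \<omega> - Z k \<omega>)\<^sup>2) \<partial>M) + 2 * (\<integral>\<^sup>+\<omega>. ennreal ((Z k \<omega>)\<^sup>2) \<partial>M)"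
    using nn_integral_power2_triangle[of X M "Z k" "\<lambda>_. 0"] by simp
  also have "\<dots> < \<infinity>"
  proof -
    have "(\<integral>\<^sup>+\<omega>. ennreal ((X \<omega> - Z k \<omega>)\<^sup>2) \<partial>M) < \<infinity>"
      using bound[of k] k by (subst nn_integral_power2_minus_commute) (metis ennreal_one_less_top infinity_ennreal_def order_le_less_trans order_less_trans)
    then show ?thesis using Z2[of k] by (simp add: integrable_power2_iff ennreal_mult_less_top)
  qed
  finally have "integrable M (\<lambda>\<omega>. (X \<omega>)\<^sup>2)" by (simp add: integrable_power2_iff)
  from that[OF X this conv] show thesis .
qed

section \<open>The filtration of the noise\<close>

lemma space_past_algebra [simp]: "space (past_algebra M Y n) = space M"
  unfolding past_algebra_def by (rule space_measure_of) auto

lemma sets_past_algebra: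
  "sets (past_algebra M Y n) =
    sigma_sets (space M) {Y k -` A \<inter> space M | k A. k < n \<and> A \<in> sets borel}"
  unfolding past_algebra_def by (rule sets_measure_of) auto

lemma sets_past_algebra_mono:
  "m \<le> n \<Longrightarrow> sets (past_algebra M Y m) \<subseteq> sets (past_algebra M Y n)"
  unfolding sets_past_algebra by (rule sigma_sets_mono') fastforce

lemma past_algebra_measurable_mono:
  assumes "f \<in> borel_measurable (past_algebra M Y m)" "m \<le> n"
  shows "f \<in> borel_measurable (past_algebra M Y n)"
  using assms sets_past_algebra_mono[OF assms(2), of M Y] by (auto simp: measurable_def)

lemma past_algebra_measurable_step:
  assumes "k < n"
  shows "Y k \<in> borel_measurable (past_algebra M Y n)"
  by (rule measurableI) (use assms in \<open>auto simp: sets_past_algebra intro!: sigma_sets.Basic\<close>)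

section \<open>Elementary integrands\<close>

text \<open>The process \<open>1\<^sub>A 1\<^sub>[\<^sub>n\<^sub>,\<^sub>\<infinity>\<^sub>)U\<close>. Besides events \<open>A\<close> of the past, \<open>A = UNIV\<close> is of interest:
  it gives the tail process itself. For this reason the lemmas below ask for \<open>A \<inter> space M\<close>,
  and not \<open>A\<close>, to be an event.\<close>

definition restricted_tail ::
    "'a set \<Rightarrow> nat \<Rightarrow> (nat \<Rightarrow> 'a \<Rightarrow> 'c::zero) \<Rightarrow> nat \<Rightarrow> 'a \<Rightarrow> 'c" where
  "restricted_tail A n U k \<omega> = (if \<omega> \<in> A then tail_process n U k \<omega> else 0)"

lemma restricted_tail_UNIV: "restricted_tail UNIV n U = tail_process n U"
  by (simp add: restricted_tail_def fun_eq_iff)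

lemma sq_norm_restricted_tail:
  "sq_norm (restricted_tail A n U) \<omega> = sq_norm (tail_process n U) \<omega> * indicator A \<omega>"
  by (cases "\<omega> \<in> A") (simp_all add: sq_norm_def restricted_tail_def)

lemma sq_norm_restricted_tail_diff_le:
  "sq_norm (\<lambda>k \<omega>. restricted_tail A n V k \<omega> - restricted_tail A n U k \<omega>) \<omega>
    \<le> sq_norm (\<lambda>k \<omega>. V k \<omega> - U k \<omega>) \<omega>"
  unfolding sq_norm_def
  by (intro suminf_le summableI) (simp add: restricted_tail_def tail_process_def)

lemma elementary_integral_restricted_tail:
  "elementary_integral Y (restricted_tail A n U) \<omega>
    = indicator A \<omega> * elementary_integral Y (tail_process n U) \<omega>"
  by (cases "\<omega> \<in> A") (simp_all add: elementary_integral_def restricted_tail_def)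

text \<open>Multiplication by \<open>1\<^sub>A\<close> keeps the process predictable because it affects only times from
  \<open>n\<close> on, when \<open>A\<close> already belongs to the past. Without the cut at \<open>n\<close> this would fail.\<close>

lemma predictable_restricted_tail:
  assumes U: "predictable M Y U" and A: "A \<inter> space M \<in> sets (past_algebra M Y n)"
  shows "predictable M Y (restricted_tail A n U)"
  unfolding predictable_def
proof
  fix k
  show "restricted_tail A n U k \<in> borel_measurable (past_algebra M Y k)"
  proof (cases "n \<le> k")
    case True
    then have A': "A \<inter> space M \<in> sets (past_algebra M Y k)"
      using A sets_past_algebra_mono by blast
    have [measurable]: "U k \<in> borel_measurable (past_algebra M Y k)"
      using U by (simp add: predictable_def)
    have "(\<lambda>\<omega>. if \<omega> \<in> A \<inter> space M then U k \<omega> else 0) \<in> borel_measurable (past_algebra M Y k)"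
      using A' by measurable
    then show ?thesis
      by (rule measurable_cong[THEN iffD1, rotated])
         (use True in \<open>simp add: restricted_tail_def tail_process_def\<close>)
  next
    case False
    then have "restricted_tail A n U k = (\<lambda>_. 0)"
      by (simp add: restricted_tail_def tail_process_def fun_eq_iff)
    then show ?thesis by simp
  qed
qed

lemma elementary_predictable_restricted_tail:
  assumes U: "elementary_predictable M Y U" and A: "A \<inter> space M \<in> sets (past_algebra M Y n)"
  shows "elementary_predictable M Y (restricted_tail A n U)"
proof -
  obtain C where C: "\<And>k \<omega>. \<omega> \<in> space M \<Longrightarrow> norm (U k \<omega>) \<le> C"
    using U unfolding elementary_predictable_def by blast
  have "norm (restricted_tail A n U k \<omega>) \<le> max C 0" if "\<omega> \<in> space M" for k \<omega>
    using C[OF that, of k] by (auto simp: restricted_tail_def tail_process_def)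
  moreover have "finite {k. \<exists>\<omega>\<in>space M. restricted_tail A n U k \<omega> \<noteq> 0}"
    by (rule finite_subset[of _ "{k. \<exists>\<omega>\<in>space M. U k \<omega> \<noteq> 0}"])
       (use U in \<open>auto simp: elementary_predictable_def restricted_tail_def tail_process_def split: if_splits\<close>)
  ultimately show ?thesis
    using U predictable_restricted_tail[OF _ A, of U] unfolding elementary_predictable_def by blast
qed

lemma approximates_restricted_tail:
  assumes "approximates M Y V U" and A: "A \<inter> space M \<in> sets (past_algebra M Y n)"
  shows "approximates M Y (\<lambda>k. restricted_tail A n (V k)) (restricted_tail A n U)"
  unfolding approximates_def
proof (intro conjI allI)
  show "elementary_predictable M Y (restricted_tail A n (V k))" for k
    using assms by (intro elementary_predictable_restricted_tail) (auto simp: approximates_def)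
  show "(\<lambda>k. \<integral>\<^sup>+\<omega>. sq_norm (\<lambda>j \<omega>. restricted_tail A n (V k) j \<omega> - restricted_tail A n U j \<omega>) \<omega> \<partial>M) \<longlonglongrightarrow> 0"
  proof (rule tendsto_sandwich[OF _ _ tendsto_const])
    show "(\<lambda>k. \<integral>\<^sup>+\<omega>. sq_norm (\<lambda>j \<omega>. V k j \<omega> - U j \<omega>) \<omega> \<partial>M) \<longlonglongrightarrow> 0"
      using assms(1) by (simp add: approximates_def)
  qed (auto intro!: always_eventually nn_integral_mono sq_norm_restricted_tail_diff_le)
qed

lemma elementary_predictable_bounded_support:
  assumes "elementary_predictable M Y V"
  obtains N where "\<And>n \<omega>. N \<le> n \<Longrightarrow> \<omega> \<in> space M \<Longrightarrow> V n \<omega> = 0"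
proof -
  have "finite {n. \<exists>\<omega>\<in>space M. V n \<omega> \<noteq> 0}"
    using assms by (simp add: elementary_predictable_def)
  then obtain N where N: "\<forall>n\<in>{n. \<exists>\<omega>\<in>space M. V n \<omega> \<noteq> 0}. n < N"
    unfolding finite_nat_set_iff_bounded by blast
  show thesis
  proof (rule that[of N], rule ccontr)
    fix n \<omega> assume "N \<le> n" "\<omega> \<in> space M" "V n \<omega> \<noteq> 0"
    then have "n < N" using N by blast
    with \<open>N \<le> n\<close> show False by simp
  qed
qed

lemma elementary_integral_eq_sum:
  assumes "\<And>n. N \<le> n \<Longrightarrow> V n \<omega> = 0"
  shows "elementary_integral Y V \<omega> = (\<Sum>n<N. V n \<omega> \<bullet> Y n \<omega>)"
  unfolding elementary_integral_def using assms by (intro suminf_finite) auto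

lemma sq_norm_eq_sum:
  assumes "\<And>n. N \<le> n \<Longrightarrow> V n \<omega> = 0"
  shows "sq_norm V \<omega> = (\<Sum>n<N. ennreal ((norm (V n \<omega>))\<^sup>2))"
  unfolding sq_norm_def using assms by (intro suminf_finite) auto

lemma elementary_predictable_diff:
  fixes V W :: "nat \<Rightarrow> 'a \<Rightarrow> 'c::{real_normed_vector, second_countable_topology}"
  assumes V: "elementary_predictable M Y V" and W: "elementary_predictable M Y W"
  shows "elementary_predictable M Y (\<lambda>n \<omega>. V n \<omega> - W n \<omega>)"
proof -
  obtain C where C: "\<And>k \<omega>. \<omega> \<in> space M \<Longrightarrow> norm (V k \<omega>) \<le> C"
    using V unfolding elementary_predictable_def by blast
  obtain D where D: "\<And>k \<omega>. \<omega> \<in> space M \<Longrightarrow> norm (W k \<omega>) \<le> D"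
    using W unfolding elementary_predictable_def by blast
  have "norm (V k \<omega> - W k \<omega>) \<le> C + D" if "\<omega> \<in> space M" for k \<omega>
    using norm_triangle_ineq4[of "V k \<omega>" "W k \<omega>"] C[OF that, of k] D[OF that, of k] by linarith
  moreover have "finite {k. \<exists>\<omega>\<in>space M. V k \<omega> - W k \<omega> \<noteq> 0}"
    by (rule finite_subset[of _ "{k. \<exists>\<omega>\<in>space M. V k \<omega> \<noteq> 0} \<union> {k. \<exists>\<omega>\<in>space M. W k \<omega> \<noteq> 0}"])
       (use V W in \<open>auto simp: elementary_predictable_def\<close>)
  moreover have "predictable M Y (\<lambda>n \<omega>. V n \<omega> - W n \<omega>)"
    using V W unfolding elementary_predictable_def predictable_def
    by (intro allI borel_measurable_diff) blast+
  ultimately show ?thesis unfolding elementary_predictable_def by blast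
qed

lemma elementary_integral_diff:
  assumes V: "elementary_predictable M Y V" and W: "elementary_predictable M Y W" and "\<omega> \<in> space M"
  shows "elementary_integral Y (\<lambda>n \<omega>. V n \<omega> - W n \<omega>) \<omega>
    = elementary_integral Y V \<omega> - elementary_integral Y W \<omega>"
proof -
  obtain K where K: "\<And>n. K \<le> n \<Longrightarrow> V n \<omega> = 0"
    using elementary_predictable_bounded_support[OF V] \<open>\<omega> \<in> space M\<close> by metis
  obtain L where L: "\<And>n. L \<le> n \<Longrightarrow> W n \<omega> = 0"
    using elementary_predictable_bounded_support[OF W] \<open>\<omega> \<in> space M\<close> by metis
  have "elementary_integral Y (\<lambda>n \<omega>. V n \<omega> - W n \<omega>) \<omega>
      = (\<Sum>n<max K L. (V n \<omega> - W n \<omega>) \<bullet> Y n \<omega>)"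
    by (rule elementary_integral_eq_sum) (simp add: K L)
  also have "\<dots> = (\<Sum>n<max K L. V n \<omega> \<bullet> Y n \<omega>) - (\<Sum>n<max K L. W n \<omega> \<bullet> Y n \<omega>)"
    by (simp only: inner_diff_left sum_subtractf)
  also have "(\<Sum>n<max K L. V n \<omega> \<bullet> Y n \<omega>) = elementary_integral Y V \<omega>"
    by (rule elementary_integral_eq_sum[symmetric]) (simp add: K)
  also have "(\<Sum>n<max K L. W n \<omega> \<bullet> Y n \<omega>) = elementary_integral Y W \<omega>"
    by (rule elementary_integral_eq_sum[symmetric]) (simp add: L)
  finally show ?thesis .
qed

section \<open>The isometry for elementary integrands\<close>

text \<open>\<open>\<bar>f g\<bar>\<close> is dominated by \<open>f\<^sup>2 + g\<^sup>2\<close>.\<close>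

lemma integrable_mult_of_power2:
  fixes f g :: "'a \<Rightarrow> real"
  assumes [measurable]: "f \<in> borel_measurable M" "g \<in> borel_measurable M"
    and f: "integrable M (\<lambda>x. (f x)\<^sup>2)" and g: "integrable M (\<lambda>x. (g x)\<^sup>2)"
  shows "integrable M (\<lambda>x. f x * g x)"
proof (rule Bochner_Integration.integrable_bound)
  show "integrable M (\<lambda>x. (f x)\<^sup>2 + (g x)\<^sup>2)" using f g by simp
  have "\<bar>f x * g x\<bar> \<le> (f x)\<^sup>2 + (g x)\<^sup>2" for x
  proof -
    have "2 * \<bar>f x * g x\<bar> \<le> (f x)\<^sup>2 + (g x)\<^sup>2"
      using sum_squares_bound[of "\<bar>f x\<bar>" "\<bar>g x\<bar>"] by (simp only: abs_mult power2_abs mult.assoc)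
    then show ?thesis by linarith
  qed
  then show "AE x in M. norm (f x * g x) \<le> norm ((f x)\<^sup>2 + (g x)\<^sup>2)" by simp
qed simp

lemma borel_measurable_vec_nth:
  fixes f :: "'a \<Rightarrow> real ^ 'd"
  assumes "f \<in> borel_measurable M"
  shows "(\<lambda>x. f x $ i) \<in> borel_measurable M"
  unfolding cart_eq_inner_axis by (intro borel_measurable_inner assms borel_measurable_const)

text \<open>A martingale difference sequence with conditional covariance the identity. The index of
  \<^const>\<open>past_algebra\<close> is such that \<^term>\<open>past_algebra M Y n\<close> knows \<open>Y\<close> strictly before time \<open>n\<close>.\<close>

locale normalized_noise = prob_space M for M :: "'a measure" +
  fixes Y :: "nat \<Rightarrow> 'a \<Rightarrow> real ^ 'd"
  assumes measurable_noise [measurable]: "\<And>n. Y n \<in> borel_measurable M"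
    and integrable_noise_power2: "\<And>n. integrable M (\<lambda>\<omega>. (norm (Y n \<omega>))\<^sup>2)"
    and cond_exp_noise:
      "\<And>n i. AE \<omega> in M. real_cond_exp M (past_algebra M Y n) (\<lambda>\<omega>. Y n \<omega> $ i) \<omega> = 0"
    and cond_exp_noise_mult:
      "\<And>n i j. AE \<omega> in M.
         real_cond_exp M (past_algebra M Y n) (\<lambda>\<omega>. Y n \<omega> $ i * Y n \<omega> $ j) \<omega>
           = (if i = j then 1 else 0)"
begin

lemma subalgebra_past: "subalgebra M (past_algebra M Y n)"
proof -
  have "sets (past_algebra M Y n) \<subseteq> sets M"
    unfolding sets_past_algebra
    by (rule sets.sigma_sets_subset) (auto simp: measurable_sets[OF measurable_noise])
  then show ?thesis by (simp add: subalgebra_def)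
qed

sublocale past: finite_measure_subalgebra M "past_algebra M Y n" for n
  by unfold_locales (rule subalgebra_past)

lemma measurable_of_past: "f \<in> borel_measurable (past_algebra M Y n) \<Longrightarrow> f \<in> borel_measurable M"
  by (rule measurable_from_subalg[OF subalgebra_past])

lemma predictable_measurable: "predictable M Y U \<Longrightarrow> U n \<in> borel_measurable M"
  by (auto simp: predictable_def intro: measurable_of_past)

lemma elementary_measurable: "elementary_predictable M Y V \<Longrightarrow> V n \<in> borel_measurable M"
  by (auto simp: elementary_predictable_def intro: predictable_measurable)

lemma measurable_noise_component [measurable]: "(\<lambda>\<omega>. Y n \<omega> $ i) \<in> borel_measurable M"
  by (rule borel_measurable_vec_nth[OF measurable_noise])

lemma integrable_noise_component_power2: "integrable M (\<lambda>\<omega>. (Y n \<omega> $ i)\<^sup>2)"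
proof (rule Bochner_Integration.integrable_bound[OF integrable_noise_power2])
  have "(Y n \<omega> $ i)\<^sup>2 \<le> (norm (Y n \<omega>))\<^sup>2" for \<omega>
    using component_le_norm_cart[of "Y n \<omega>" i] by (simp add: abs_le_square_iff[symmetric])
  then show "AE \<omega> in M. norm ((Y n \<omega> $ i)\<^sup>2) \<le> norm ((norm (Y n \<omega>))\<^sup>2)" by simp
qed simp

text \<open>The factor known from the past can be moved outside the conditional expectation of the noise,
  which vanishes. The assumption on \<open>H\<close> is square integrability and not boundedness because in
  \<open>isometry_step\<close> it contains the partial sum of the integral, which is unbounded.\<close>

lemma expectation_past_mult_noise:
  assumes H: "H \<in> borel_measurable (past_algebra M Y n)" and H2: "integrable M (\<lambda>\<omega>. (H \<omega>)\<^sup>2)"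
  shows "integrable M (\<lambda>\<omega>. H \<omega> * Y n \<omega> $ i)" "expectation (\<lambda>\<omega>. H \<omega> * Y n \<omega> $ i) = 0"
proof -
  show int: "integrable M (\<lambda>\<omega>. H \<omega> * Y n \<omega> $ i)"
    by (rule integrable_mult_of_power2[OF measurable_of_past[OF H] _ H2 integrable_noise_component_power2]) simp
  have "expectation (\<lambda>\<omega>. H \<omega> * Y n \<omega> $ i)
      = expectation (\<lambda>\<omega>. H \<omega> * real_cond_exp M (past_algebra M Y n) (\<lambda>\<omega>. Y n \<omega> $ i) \<omega>)"
    by (rule past.real_cond_exp_intg(2)[OF int H, symmetric]) simp
  also have "\<dots> = expectation (\<lambda>\<omega>. 0)"
    using cond_exp_noise[of n i] measurable_of_past[OF H]
    by (intro integral_cong_AE) (auto elim: eventually_mono)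
  finally show "expectation (\<lambda>\<omega>. H \<omega> * Y n \<omega> $ i) = 0" by simp
qed

text \<open>The same for products of two noise components. These are merely integrable, so \<open>H\<close> is taken
  bounded; in \<open>isometry_step\<close> it is a product of components of the bounded integrand.\<close>

lemma expectation_past_mult_noise_mult:
  assumes H: "H \<in> borel_measurable (past_algebra M Y n)" and C: "\<And>\<omega>. \<omega> \<in> space M \<Longrightarrow> \<bar>H \<omega>\<bar> \<le> C"
  shows "integrable M (\<lambda>\<omega>. H \<omega> * (Y n \<omega> $ i * Y n \<omega> $ j))"
    and "expectation (\<lambda>\<omega>. H \<omega> * (Y n \<omega> $ i * Y n \<omega> $ j)) = (if i = j then expectation H else 0)"
proof -
  have HM [measurable]: "H \<in> borel_measurable M" by (rule measurable_of_past[OF H])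
  have YY: "integrable M (\<lambda>\<omega>. Y n \<omega> $ i * Y n \<omega> $ j)"
    by (intro integrable_mult_of_power2 integrable_noise_component_power2) simp_all
  show int: "integrable M (\<lambda>\<omega>. H \<omega> * (Y n \<omega> $ i * Y n \<omega> $ j))"
  proof (rule Bochner_Integration.integrable_bound)
    show "integrable M (\<lambda>\<omega>. C * (Y n \<omega> $ i * Y n \<omega> $ j))" using YY by simp
    have "\<bar>H \<omega>\<bar> * \<bar>Y n \<omega> $ i * Y n \<omega> $ j\<bar> \<le> \<bar>C\<bar> * \<bar>Y n \<omega> $ i * Y n \<omega> $ j\<bar>"
      if "\<omega> \<in> space M" for \<omega>
      using C[OF that] by (intro mult_right_mono) auto
    then show "AE \<omega> in M. norm (H \<omega> * (Y n \<omega> $ i * Y n \<omega> $ j)) \<le> norm (C * (Y n \<omega> $ i * Y n \<omega> $ j))"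
      by (intro AE_I2) (simp add: abs_mult mult.assoc)
  qed simp
  have "expectation (\<lambda>\<omega>. H \<omega> * (Y n \<omega> $ i * Y n \<omega> $ j))
      = expectation (\<lambda>\<omega>. H \<omega> * real_cond_exp M (past_algebra M Y n) (\<lambda>\<omega>. Y n \<omega> $ i * Y n \<omega> $ j) \<omega>)"
    by (rule past.real_cond_exp_intg(2)[OF int H, symmetric]) simp
  also have "\<dots> = expectation (\<lambda>\<omega>. H \<omega> * (if i = j then 1 else 0))"
    using cond_exp_noise_mult[of n i j]
    by (intro integral_cong_AE) (auto elim: eventually_mono)
  finally show "expectation (\<lambda>\<omega>. H \<omega> * (Y n \<omega> $ i * Y n \<omega> $ j)) = (if i = j then expectation H else 0)"
    by simp
qed

text \<open>One step of the Pythagorean identity. Written in coordinates, the cross terms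
  \<open>S v\<^sub>i Y\<^sub>i\<close> have mean zero, and of the terms \<open>v\<^sub>i v\<^sub>j Y\<^sub>i Y\<^sub>j\<close> only the diagonal ones survive.\<close>

lemma isometry_step:
  assumes S: "S \<in> borel_measurable (past_algebra M Y n)" and S2: "integrable M (\<lambda>\<omega>. (S \<omega>)\<^sup>2)"
    and v: "v \<in> borel_measurable (past_algebra M Y n)" and C: "\<And>\<omega>. \<omega> \<in> space M \<Longrightarrow> norm (v \<omega>) \<le> C"
  shows "integrable M (\<lambda>\<omega>. (S \<omega> + v \<omega> \<bullet> Y n \<omega>)\<^sup>2)"
    and "expectation (\<lambda>\<omega>. (S \<omega> + v \<omega> \<bullet> Y n \<omega>)\<^sup>2)
      = expectation (\<lambda>\<omega>. (S \<omega>)\<^sup>2) + expectation (\<lambda>\<omega>. (norm (v \<omega>))\<^sup>2)"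
proof -
  have [measurable]: "S \<in> borel_measurable M" "v \<in> borel_measurable M"
    by (simp_all add: measurable_of_past[OF S] measurable_of_past[OF v])
  have vi: "(\<lambda>\<omega>. v \<omega> $ i) \<in> borel_measurable (past_algebra M Y n)" for i
    by (rule borel_measurable_vec_nth[OF v])
  have [measurable]: "(\<lambda>\<omega>. v \<omega> $ i) \<in> borel_measurable M" for i
    by (rule measurable_of_past[OF vi])
  have vC: "\<bar>v \<omega> $ i\<bar> \<le> C" if "\<omega> \<in> space M" for \<omega> i
    using component_le_norm_cart[of "v \<omega>" i] C[OF that] by linarith
  have vvC: "\<bar>v \<omega> $ i * v \<omega> $ j\<bar> \<le> C * C" if "\<omega> \<in> space M" for \<omega> i j
    unfolding abs_mult using vC[OF that, of i] vC[OF that, of j] by (intro mult_mono) auto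
  have Sv: "integrable M (\<lambda>\<omega>. (S \<omega> * v \<omega> $ i)\<^sup>2)" for i
  proof (rule Bochner_Integration.integrable_bound)
    show "integrable M (\<lambda>\<omega>. (C * S \<omega>)\<^sup>2)" using S2 by (simp add: power_mult_distrib)
    have "(S \<omega> * v \<omega> $ i)\<^sup>2 \<le> (C * S \<omega>)\<^sup>2" if "\<omega> \<in> space M" for \<omega>
    proof -
      have "(v \<omega> $ i)\<^sup>2 \<le> C\<^sup>2" using vC[OF that, of i] by (simp add: abs_le_square_iff[symmetric])
      then show ?thesis
        unfolding power_mult_distrib by (subst mult.commute) (rule mult_right_mono, simp_all)
    qed
    then show "AE \<omega> in M. norm ((S \<omega> * v \<omega> $ i)\<^sup>2) \<le> norm ((C * S \<omega>)\<^sup>2)" by simp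
  qed simp
  note cross = expectation_past_mult_noise[OF borel_measurable_times[OF S vi] Sv]
  note diag = expectation_past_mult_noise_mult[OF borel_measurable_times[OF vi vi] vvC]
  have int_vv: "integrable M (\<lambda>\<omega>. v \<omega> $ i * v \<omega> $ j)" for i j
    by (rule integrable_const_bound[where B="C * C"]) (use vvC in auto)
  have expand: "(S \<omega> + v \<omega> \<bullet> Y n \<omega>)\<^sup>2 = (S \<omega>)\<^sup>2 + 2 * (\<Sum>i\<in>UNIV. S \<omega> * v \<omega> $ i * Y n \<omega> $ i)
      + (\<Sum>i\<in>UNIV. \<Sum>j\<in>UNIV. v \<omega> $ i * v \<omega> $ j * (Y n \<omega> $ i * Y n \<omega> $ j))" for \<omega>
  proof -
    have "v \<omega> \<bullet> Y n \<omega> = (\<Sum>i\<in>UNIV. v \<omega> $ i * Y n \<omega> $ i)"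
      by (simp add: inner_vec_def)
    moreover from this have "(v \<omega> \<bullet> Y n \<omega>)\<^sup>2 = (\<Sum>i\<in>UNIV. \<Sum>j\<in>UNIV. v \<omega> $ i * v \<omega> $ j * (Y n \<omega> $ i * Y n \<omega> $ j))"
      by (simp add: power2_eq_square sum_product mult_ac)
    ultimately show ?thesis
      by (simp add: power2_sum sum_distrib_left mult_ac)
  qed
  show "integrable M (\<lambda>\<omega>. (S \<omega> + v \<omega> \<bullet> Y n \<omega>)\<^sup>2)"
    unfolding expand using S2 cross(1) diag(1) by simp
  have "expectation (\<lambda>\<omega>. (S \<omega> + v \<omega> \<bullet> Y n \<omega>)\<^sup>2) = expectation (\<lambda>\<omega>. (S \<omega>)\<^sup>2)
      + 2 * (\<Sum>i\<in>UNIV. expectation (\<lambda>\<omega>. S \<omega> * v \<omega> $ i * Y n \<omega> $ i))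
      + (\<Sum>i\<in>UNIV. \<Sum>j\<in>UNIV. expectation (\<lambda>\<omega>. v \<omega> $ i * v \<omega> $ j * (Y n \<omega> $ i * Y n \<omega> $ j)))"
    unfolding expand using S2 cross(1) diag(1) by simp
  also have "\<dots> = expectation (\<lambda>\<omega>. (S \<omega>)\<^sup>2) + (\<Sum>i\<in>UNIV. expectation (\<lambda>\<omega>. v \<omega> $ i * v \<omega> $ i))"
    by (simp add: cross(2) diag(2))
  also have "(\<Sum>i\<in>UNIV. expectation (\<lambda>\<omega>. v \<omega> $ i * v \<omega> $ i)) = expectation (\<lambda>\<omega>. (norm (v \<omega>))\<^sup>2)"
    using int_vv by (simp add: power2_norm_eq_inner inner_vec_def)
  finally show "expectation (\<lambda>\<omega>. (S \<omega> + v \<omega> \<bullet> Y n \<omega>)\<^sup>2)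
      = expectation (\<lambda>\<omega>. (S \<omega>)\<^sup>2) + expectation (\<lambda>\<omega>. (norm (v \<omega>))\<^sup>2)" .
qed

lemma measurable_elementary_integral:
  assumes "elementary_predictable M Y V"
  shows "elementary_integral Y V \<in> borel_measurable M"
proof -
  obtain N where N: "\<And>n \<omega>. N \<le> n \<Longrightarrow> \<omega> \<in> space M \<Longrightarrow> V n \<omega> = 0"
    using elementary_predictable_bounded_support[OF assms] by blast
  note [measurable] = elementary_measurable[OF assms]
  have "(\<lambda>\<omega>. \<Sum>n<N. V n \<omega> \<bullet> Y n \<omega>) \<in> borel_measurable M" by measurable
  then show ?thesis
    by (rule measurable_cong[THEN iffD1, rotated]) (intro elementary_integral_eq_sum[symmetric] N)
qed

lemma elementary_isometry:
  assumes V: "elementary_predictable M Y V"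
  shows "integrable M (\<lambda>\<omega>. (elementary_integral Y V \<omega>)\<^sup>2)"
    and "(\<integral>\<^sup>+\<omega>. ennreal ((elementary_integral Y V \<omega>)\<^sup>2) \<partial>M) = (\<integral>\<^sup>+\<omega>. sq_norm V \<omega> \<partial>M)"
proof -
  obtain N where N: "\<And>n \<omega>. N \<le> n \<Longrightarrow> \<omega> \<in> space M \<Longrightarrow> V n \<omega> = 0"
    using elementary_predictable_bounded_support[OF V] by blast
  obtain C where C: "\<And>k \<omega>. \<omega> \<in> space M \<Longrightarrow> norm (V k \<omega>) \<le> C"
    using V unfolding elementary_predictable_def by blast
  have VF: "V k \<in> borel_measurable (past_algebra M Y k)" for k
    using V by (simp add: elementary_predictable_def predictable_def)
  note [measurable] = elementary_measurable[OF V]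
  have V2: "integrable M (\<lambda>\<omega>. (norm (V k \<omega>))\<^sup>2)" for k
    by (rule integrable_const_bound[where B="C\<^sup>2"]) (use C in \<open>auto intro!: power_mono\<close>)
  have partial_sum_measurable: "(\<lambda>\<omega>. \<Sum>k<n. V k \<omega> \<bullet> Y k \<omega>) \<in> borel_measurable (past_algebra M Y n)" for n
    by (intro borel_measurable_sum borel_measurable_inner past_algebra_measurable_step
        past_algebra_measurable_mono[OF VF]) auto
  have partial: "integrable M (\<lambda>\<omega>. (\<Sum>k<n. V k \<omega> \<bullet> Y k \<omega>)\<^sup>2) \<and>
      expectation (\<lambda>\<omega>. (\<Sum>k<n. V k \<omega> \<bullet> Y k \<omega>)\<^sup>2) = (\<Sum>k<n. expectation (\<lambda>\<omega>. (norm (V k \<omega>))\<^sup>2))" for n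
  proof (induction n)
    case (Suc n)
    then show ?case
      using isometry_step[OF partial_sum_measurable _ VF C, of n] by simp
  qed simp
  have EI: "elementary_integral Y V \<omega> = (\<Sum>k<N. V k \<omega> \<bullet> Y k \<omega>)" if "\<omega> \<in> space M" for \<omega>
    using N that by (intro elementary_integral_eq_sum)
  show "integrable M (\<lambda>\<omega>. (elementary_integral Y V \<omega>)\<^sup>2)"
    using partial[of N] by (simp add: EI cong: Bochner_Integration.integrable_cong)
  have "(\<integral>\<^sup>+\<omega>. ennreal ((elementary_integral Y V \<omega>)\<^sup>2) \<partial>M)
      = (\<integral>\<^sup>+\<omega>. ennreal ((\<Sum>k<N. V k \<omega> \<bullet> Y k \<omega>)\<^sup>2) \<partial>M)"
    by (intro nn_integral_cong) (simp add: EI)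
  also have "\<dots> = ennreal (\<Sum>k<N. expectation (\<lambda>\<omega>. (norm (V k \<omega>))\<^sup>2))"
    using partial[of N] by (simp add: nn_integral_eq_integral)
  also have "\<dots> = (\<Sum>k<N. \<integral>\<^sup>+\<omega>. ennreal ((norm (V k \<omega>))\<^sup>2) \<partial>M)"
    by (simp add: nn_integral_eq_integral V2 sum_ennreal)
  also have "\<dots> = (\<integral>\<^sup>+\<omega>. (\<Sum>k<N. ennreal ((norm (V k \<omega>))\<^sup>2)) \<partial>M)"
    by (rule nn_integral_sum[symmetric]) simp
  also have "\<dots> = (\<integral>\<^sup>+\<omega>. sq_norm V \<omega> \<partial>M)"
    by (intro nn_integral_cong sq_norm_eq_sum[symmetric] N)
  finally show "(\<integral>\<^sup>+\<omega>. ennreal ((elementary_integral Y V \<omega>)\<^sup>2) \<partial>M) = (\<integral>\<^sup>+\<omega>. sq_norm V \<omega> \<partial>M)" .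
qed

section \<open>The stochastic integral as a mean square limit\<close>

lemma measurable_approximants:
  assumes "approximates M Y V U"
  shows "V k n \<in> borel_measurable M" "elementary_integral Y (V k) \<in> borel_measurable M"
  using assms by (auto simp: approximates_def intro: elementary_measurable measurable_elementary_integral)

text \<open>By linearity and the isometry the left-hand side is the squared distance of \<open>V\<close> and \<open>W\<close>.
  Comparing both with \<open>U\<close> yields at once the Cauchy property of the integrals along one approximation
  and the agreement of the limits along two of them.\<close>

lemma elementary_integral_dist_le:
  assumes V: "elementary_predictable M Y V" and W: "elementary_predictable M Y W"
    and U [measurable]: "\<And>n. U n \<in> borel_measurable M"
  shows "(\<integral>\<^sup>+\<omega>. ennreal ((elementary_integral Y V \<omega> - elementary_integral Y W \<omega>)\<^sup>2) \<partial>M)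
    \<le> 2 * (\<integral>\<^sup>+\<omega>. sq_norm (\<lambda>n \<omega>. V n \<omega> - U n \<omega>) \<omega> \<partial>M)
      + 2 * (\<integral>\<^sup>+\<omega>. sq_norm (\<lambda>n \<omega>. W n \<omega> - U n \<omega>) \<omega> \<partial>M)"
proof -
  note [measurable] = elementary_measurable[OF V] elementary_measurable[OF W]
  have "(\<integral>\<^sup>+\<omega>. ennreal ((elementary_integral Y V \<omega> - elementary_integral Y W \<omega>)\<^sup>2) \<partial>M)
      = (\<integral>\<^sup>+\<omega>. ennreal ((elementary_integral Y (\<lambda>n \<omega>. V n \<omega> - W n \<omega>) \<omega>)\<^sup>2) \<partial>M)"
    by (intro nn_integral_cong) (simp add: elementary_integral_diff[OF V W])
  also have "\<dots> = (\<integral>\<^sup>+\<omega>. sq_norm (\<lambda>n \<omega>. V n \<omega> - W n \<omega>) \<omega> \<partial>M)"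
    by (rule elementary_isometry(2)[OF elementary_predictable_diff[OF V W]])
  also have "\<dots> \<le> 2 * (\<integral>\<^sup>+\<omega>. sq_norm (\<lambda>n \<omega>. V n \<omega> - U n \<omega>) \<omega> \<partial>M)
      + 2 * (\<integral>\<^sup>+\<omega>. sq_norm (\<lambda>n \<omega>. U n \<omega> - W n \<omega>) \<omega> \<partial>M)"
    using nn_integral_sq_norm_perturb[of 1 "\<lambda>n \<omega>. V n \<omega> - W n \<omega>" M "\<lambda>n \<omega>. V n \<omega> - U n \<omega>"] by simp
  finally show ?thesis by (simp only: sq_norm_minus_commute[of U W])
qed

lemma approximates_imp_tendsto:
  assumes "approximates M Y V U"
  shows "(\<lambda>k. 2 * (\<integral>\<^sup>+\<omega>. sq_norm (\<lambda>n \<omega>. V k n \<omega> - U n \<omega>) \<omega> \<partial>M)) \<longlonglongrightarrow> 0"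
proof -
  have "(\<lambda>k. 2 * (\<integral>\<^sup>+\<omega>. sq_norm (\<lambda>n \<omega>. V k n \<omega> - U n \<omega>) \<omega> \<partial>M)) \<longlonglongrightarrow> 2 * 0"
    using assms unfolding approximates_def by (intro ennreal_tendsto_cmult) simp_all
  then show ?thesis by simp
qed

lemma approximates_imp_L2_converges:
  assumes V: "approximates M Y V U" and U: "\<And>n. U n \<in> borel_measurable M"
  obtains X where "X \<in> borel_measurable M" "integrable M (\<lambda>\<omega>. (X \<omega>)\<^sup>2)"
    "L2_converges M (\<lambda>k. elementary_integral Y (V k)) X"
proof (rule L2_complete)
  have el: "elementary_predictable M Y (V k)" for k using V by (simp add: approximates_def)
  show "elementary_integral Y (V k) \<in> borel_measurable M" for k
    by (rule measurable_approximants(2)[OF V])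
  show "integrable M (\<lambda>\<omega>. (elementary_integral Y (V k) \<omega>)\<^sup>2)" for k
    by (rule elementary_isometry(1)[OF el])
  show "(\<lambda>k. 2 * (\<integral>\<^sup>+\<omega>. sq_norm (\<lambda>n \<omega>. V k n \<omega> - U n \<omega>) \<omega> \<partial>M)) \<longlonglongrightarrow> 0"
    by (rule approximates_imp_tendsto[OF V])
  show "(\<integral>\<^sup>+\<omega>. ennreal ((elementary_integral Y (V i) \<omega> - elementary_integral Y (V j) \<omega>)\<^sup>2) \<partial>M)
    \<le> 2 * (\<integral>\<^sup>+\<omega>. sq_norm (\<lambda>n \<omega>. V i n \<omega> - U n \<omega>) \<omega> \<partial>M)
      + 2 * (\<integral>\<^sup>+\<omega>. sq_norm (\<lambda>n \<omega>. V j n \<omega> - U n \<omega>) \<omega> \<partial>M)" for i j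
    by (rule elementary_integral_dist_le[OF el el U])
qed (rule that)

lemma L2_converges_approximation_independent:
  assumes V: "approximates M Y V U" and W: "approximates M Y W U"
    and U: "\<And>n. U n \<in> borel_measurable M" and X: "X \<in> borel_measurable M"
    and conv: "L2_converges M (\<lambda>k. elementary_integral Y (V k)) X"
  shows "L2_converges M (\<lambda>k. elementary_integral Y (W k)) X"
proof (rule L2_converges_transfer[OF _ _ X conv])
  show "(\<lambda>k. 2 * (\<integral>\<^sup>+\<omega>. sq_norm (\<lambda>n \<omega>. W k n \<omega> - U n \<omega>) \<omega> \<partial>M)
      + 2 * (\<integral>\<^sup>+\<omega>. sq_norm (\<lambda>n \<omega>. V k n \<omega> - U n \<omega>) \<omega> \<partial>M)) \<longlonglongrightarrow> 0"
    using tendsto_add[OF approximates_imp_tendsto[OF W] approximates_imp_tendsto[OF V]] by simp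
  show "(\<integral>\<^sup>+\<omega>. ennreal ((elementary_integral Y (W k) \<omega> - elementary_integral Y (V k) \<omega>)\<^sup>2) \<partial>M)
    \<le> 2 * (\<integral>\<^sup>+\<omega>. sq_norm (\<lambda>n \<omega>. W k n \<omega> - U n \<omega>) \<omega> \<partial>M)
      + 2 * (\<integral>\<^sup>+\<omega>. sq_norm (\<lambda>n \<omega>. V k n \<omega> - U n \<omega>) \<omega> \<partial>M)" for k
    using V W by (intro elementary_integral_dist_le U) (simp_all add: approximates_def)
qed (rule measurable_approximants(2)[OF V] measurable_approximants(2)[OF W])+

text \<open>The approximation cuts \<open>U\<close> off at time \<open>k\<close> and where its norm exceeds \<open>k\<close>; both conditions at
  time \<open>n\<close> depend on \<open>U\<^sub>n\<close> only, so predictability is kept. Convergence is dominated convergence,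
  used twice: in time for a fixed outcome, where \<open>\<parallel>U\<^sub>n\<parallel>\<^sup>2\<close> is the dominating summable
  sequence, and then over the outcomes, where \<open>\<parallel>U\<parallel>\<^sup>2\<close> dominates.\<close>

lemma exists_approximation:
  assumes U: "predictable M Y U" and U2: "square_integrable M U"
  shows "\<exists>V. approximates M Y V U"
proof
  define V where "V = (\<lambda>k n \<omega>. if n < k \<and> norm (U n \<omega>) \<le> real k then U n \<omega> else 0)"
  note [measurable] = predictable_measurable[OF U]
  have [measurable]: "V k n \<in> borel_measurable M" for k n
    unfolding V_def by measurable
  have V: "elementary_predictable M Y (V k)" for k
  proof -
    have "predictable M Y (V k)"
      unfolding predictable_def
    proof
      fix n
      have [measurable]: "U n \<in> borel_measurable (past_algebra M Y n)"
        using U by (simp add: predictable_def)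
      show "V k n \<in> borel_measurable (past_algebra M Y n)"
        unfolding V_def by measurable
    qed
    moreover have "norm (V k n \<omega>) \<le> real k" for n \<omega> by (simp add: V_def)
    moreover have "finite {n. \<exists>\<omega>\<in>space M. V k n \<omega> \<noteq> 0}"
      by (rule finite_subset[of _ "{..<k}"]) (auto simp: V_def split: if_splits)
    ultimately show ?thesis unfolding elementary_predictable_def by blast
  qed
  let ?D = "\<lambda>k. sq_norm (\<lambda>n \<omega>. V k n \<omega> - U n \<omega>)"
  have term_le: "ennreal ((norm (V k n \<omega> - U n \<omega>))\<^sup>2) \<le> ennreal ((norm (U n \<omega>))\<^sup>2)" for k n \<omega>
    by (simp add: V_def)
  have term_lim: "(\<lambda>k. ennreal ((norm (V k n \<omega> - U n \<omega>))\<^sup>2)) \<longlonglongrightarrow> 0" for n \<omega>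
  proof (rule tendsto_eventually)
    obtain K where K: "norm (U n \<omega>) \<le> real K" using real_arch_simple by blast
    have "ennreal ((norm (V k n \<omega> - U n \<omega>))\<^sup>2) = 0" if "max (Suc n) K \<le> k" for k
    proof -
      have "norm (U n \<omega>) \<le> real k" using K that by simp
      then show ?thesis using that by (simp add: V_def)
    qed
    then show "\<forall>\<^sub>F k in sequentially. ennreal ((norm (V k n \<omega> - U n \<omega>))\<^sup>2) = 0"
      by (intro eventually_sequentiallyI)
  qed
  have D_lim: "(\<lambda>k. ?D k \<omega>) \<longlonglongrightarrow> 0" if "sq_norm U \<omega> < \<infinity>" for \<omega>
  proof -
    have "(\<lambda>k. \<integral>\<^sup>+n. ennreal ((norm (V k n \<omega> - U n \<omega>))\<^sup>2) \<partial>count_space UNIV)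
        \<longlonglongrightarrow> (\<integral>\<^sup>+n. 0 \<partial>count_space (UNIV::nat set))"
      by (rule nn_integral_dominated_convergence[where w="\<lambda>n. ennreal ((norm (U n \<omega>))\<^sup>2)"])
         (use that term_le term_lim in \<open>auto simp: nn_integral_count_space_nat sq_norm_def\<close>)
    then show ?thesis by (simp add: nn_integral_count_space_nat sq_norm_def)
  qed
  have "(\<lambda>k. \<integral>\<^sup>+\<omega>. ?D k \<omega> \<partial>M) \<longlonglongrightarrow> (\<integral>\<^sup>+\<omega>. 0 \<partial>M)"
  proof (rule nn_integral_dominated_convergence[where w="sq_norm U"])
    show "?D k \<in> borel_measurable M" for k by (rule measurable_sq_norm) simp
    show "sq_norm U \<in> borel_measurable M" by (rule measurable_sq_norm) simp
    show fin: "(\<integral>\<^sup>+\<omega>. sq_norm U \<omega> \<partial>M) < \<infinity>" using U2 by (simp add: square_integrable_def)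
    show "AE \<omega> in M. ?D k \<omega> \<le> sq_norm U \<omega>" for k
      unfolding sq_norm_def by (intro AE_I2 suminf_le summableI term_le)
    have "AE \<omega> in M. sq_norm U \<omega> \<noteq> \<infinity>"
      using fin by (intro nn_integral_noteq_infinite measurable_sq_norm) simp_all
    then show "AE \<omega> in M. (\<lambda>k. ?D k \<omega>) \<longlonglongrightarrow> 0"
      by eventually_elim (rule D_lim, simp add: less_top)
  qed simp
  then show "approximates M Y V U" using V by (simp add: approximates_def)
qed

lemma is_stochastic_integral_stochastic_integral:
  assumes U: "predictable M Y U" "square_integrable M U"
  shows "is_stochastic_integral M Y U (stochastic_integral M Y U)"
proof -
  obtain V where V: "approximates M Y V U" using exists_approximation[OF U] by blast
  obtain X where "X \<in> borel_measurable M" "integrable M (\<lambda>\<omega>. (X \<omega>)\<^sup>2)"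
    "L2_converges M (\<lambda>k. elementary_integral Y (V k)) X"
    using approximates_imp_L2_converges[OF V predictable_measurable[OF U(1)]] by blast
  with V have "is_stochastic_integral M Y U X" unfolding is_stochastic_integral_def by blast
  then show ?thesis unfolding stochastic_integral_def by (rule someI[of "is_stochastic_integral M Y U"])
qed

lemma is_stochastic_integral_approximates:
  assumes X: "is_stochastic_integral M Y U X" and U: "predictable M Y U" and W: "approximates M Y W U"
  shows "L2_converges M (\<lambda>k. elementary_integral Y (W k)) X"
proof -
  obtain V where "approximates M Y V U" "L2_converges M (\<lambda>k. elementary_integral Y (V k)) X"
    using X unfolding is_stochastic_integral_def by blast
  moreover have "X \<in> borel_measurable M" using X by (simp add: is_stochastic_integral_def)
  ultimately show ?thesis
    using L2_converges_approximation_independent[OF _ W predictable_measurable[OF U]] by blast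
qed

text \<open>An elementary process is approximated by the constant sequence.\<close>

lemma is_stochastic_integral_elementary:
  assumes X: "is_stochastic_integral M Y U X" and U: "elementary_predictable M Y U"
  shows "AE \<omega> in M. X \<omega> = elementary_integral Y U \<omega>"
proof (rule L2_converges_const_AE_eq)
  show "elementary_integral Y U \<in> borel_measurable M" by (rule measurable_elementary_integral[OF U])
  show "X \<in> borel_measurable M" using X by (simp add: is_stochastic_integral_def)
  have "approximates M Y (\<lambda>k. U) U" using U by (simp add: approximates_def sq_norm_def)
  with X U show "L2_converges M (\<lambda>k. elementary_integral Y U) X"
    by (intro is_stochastic_integral_approximates) (simp_all add: elementary_predictable_def)
qed

section \<open>The isometry and its conditional form\<close>

text \<open>The elementary isometry identifies the squared norms of \<open>V\<^sub>k\<close> and of its integral. The former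
  approaches the squared norm of \<open>U\<close> and the latter that of \<open>X\<close>, so each of these two is bounded by the
  other.\<close>

lemma L2_limit_isometry:
  assumes V: "approximates M Y V U" and U: "\<And>n. U n \<in> borel_measurable M"
    and X: "X \<in> borel_measurable M" and conv: "L2_converges M (\<lambda>k. elementary_integral Y (V k)) X"
  shows "(\<integral>\<^sup>+\<omega>. ennreal ((X \<omega>)\<^sup>2) \<partial>M) = (\<integral>\<^sup>+\<omega>. sq_norm U \<omega> \<partial>M)"
proof -
  have el: "elementary_predictable M Y (V k)" for k using V by (simp add: approximates_def)
  define b where "b = (\<lambda>k. \<integral>\<^sup>+\<omega>. sq_norm (V k) \<omega> \<partial>M)"
  define c where "c = (\<lambda>k. \<integral>\<^sup>+\<omega>. ennreal ((elementary_integral Y (V k) \<omega> - X \<omega>)\<^sup>2) \<partial>M)"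
  define d where "d = (\<lambda>k. \<integral>\<^sup>+\<omega>. sq_norm (\<lambda>n \<omega>. V k n \<omega> - U n \<omega>) \<omega> \<partial>M)"
  have c0: "c \<longlonglongrightarrow> 0" using conv by (simp add: c_def L2_converges_def)
  have d0: "d \<longlonglongrightarrow> 0" using V by (simp add: d_def approximates_def)
  note mV = measurable_approximants[OF V]
  have X_le: "(\<integral>\<^sup>+\<omega>. ennreal ((X \<omega>)\<^sup>2) \<partial>M) \<le> ennreal (1 + e) * b k + ennreal (1 + 1/e) * c k"
    if "0 < e" for k e
    using nn_integral_power2_perturb[OF that X mV(2)[of k]]
    by (simp only: b_def c_def elementary_isometry(2)[OF el] nn_integral_power2_minus_commute[of _ X])
  have le_X: "b k \<le> ennreal (1 + e) * (\<integral>\<^sup>+\<omega>. ennreal ((X \<omega>)\<^sup>2) \<partial>M) + ennreal (1 + 1/e) * c k"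
    if "0 < e" for k e
    using nn_integral_power2_perturb[OF that mV(2)[of k] X]
    by (simp only: b_def c_def elementary_isometry(2)[OF el])
  have U_le: "(\<integral>\<^sup>+\<omega>. sq_norm U \<omega> \<partial>M) \<le> ennreal (1 + e) * b k + ennreal (1 + 1/e) * d k"
    if "0 < e" for k e
    using nn_integral_sq_norm_perturb[OF that, of U M "V k", OF U mV(1)]
    by (simp only: b_def d_def sq_norm_minus_commute[of U])
  have le_U: "b k \<le> ennreal (1 + e) * (\<integral>\<^sup>+\<omega>. sq_norm U \<omega> \<partial>M) + ennreal (1 + 1/e) * d k"
    if "0 < e" for k e
    using nn_integral_sq_norm_perturb[OF that, of "V k" M U, OF mV(1) U] by (simp only: b_def d_def)
  show ?thesis
    using le_of_mean_square_limits[OF X_le le_U c0 d0] le_of_mean_square_limits[OF U_le le_X d0 c0]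
    by (rule antisym)
qed

text \<open>The isometry applied to \<open>1\<^sub>A 1\<^sub>[\<^sub>n\<^sub>,\<^sub>\<infinity>\<^sub>)U\<close>. An approximation \<open>V\<close> of \<open>U\<close> yields approximations of both
  \<open>1\<^sub>[\<^sub>n\<^sub>,\<^sub>\<infinity>\<^sub>)U\<close> and \<open>1\<^sub>A 1\<^sub>[\<^sub>n\<^sub>,\<^sub>\<infinity>\<^sub>)U\<close>, whose elementary integrals differ by the factor \<open>1\<^sub>A\<close>; hence
  \<open>1\<^sub>A X\<close> is the limit of the latter.\<close>

lemma restricted_isometry:
  assumes U: "predictable M Y U" "square_integrable M U"
    and X: "is_stochastic_integral M Y (tail_process n U) X"
    and A: "A \<in> sets (past_algebra M Y n)"
  shows "(\<integral>\<^sup>+\<omega>. ennreal ((X \<omega>)\<^sup>2) * indicator A \<omega> \<partial>M)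
    = (\<integral>\<^sup>+\<omega>. sq_norm (tail_process n U) \<omega> * indicator A \<omega> \<partial>M)"
proof -
  have AM: "A \<inter> space M \<in> sets (past_algebra M Y n)"
    using A sets.sets_into_space[OF A] by (simp add: Int_absorb2)
  have UM: "UNIV \<inter> space M \<in> sets (past_algebra M Y n)"
    using sets.top[of "past_algebra M Y n"] by simp
  note [measurable] = subsetD[OF subalgebra_past[unfolded subalgebra_def, THEN conjunct2] A]
  have [measurable]: "X \<in> borel_measurable M" using X by (simp add: is_stochastic_integral_def)
  obtain V where V: "approximates M Y V U" using exists_approximation[OF U] by blast
  have "approximates M Y (\<lambda>k. tail_process n (V k)) (tail_process n U)"
    using approximates_restricted_tail[OF V UM] by (simp add: restricted_tail_UNIV)
  moreover have "predictable M Y (tail_process n U)"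
    using predictable_restricted_tail[OF U(1) UM] by (simp add: restricted_tail_UNIV)
  ultimately have "L2_converges M (\<lambda>k. elementary_integral Y (tail_process n (V k))) X"
    by (intro is_stochastic_integral_approximates[OF X])
  then have "L2_converges M (\<lambda>k. elementary_integral Y (restricted_tail A n (V k))) (\<lambda>\<omega>. indicator A \<omega> * X \<omega>)"
    using L2_converges_indicator[of M _ X A]
    by (simp add: elementary_integral_restricted_tail[abs_def])
  then have "(\<integral>\<^sup>+\<omega>. ennreal ((indicator A \<omega> * X \<omega>)\<^sup>2) \<partial>M) = (\<integral>\<^sup>+\<omega>. sq_norm (restricted_tail A n U) \<omega> \<partial>M)"
    by (intro L2_limit_isometry[OF approximates_restricted_tail[OF V AM]]
        predictable_measurable[OF predictable_restricted_tail[OF U(1) AM]]) simp_all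
  moreover have "ennreal ((indicator A \<omega> * X \<omega>)\<^sup>2) = ennreal ((X \<omega>)\<^sup>2) * indicator A \<omega>" for \<omega>
    by (simp add: indicator_def)
  ultimately show ?thesis by (simp add: sq_norm_restricted_tail)
qed

lemma conditional_isometry:
  assumes U: "predictable M Y U" "square_integrable M U"
    and X: "is_stochastic_integral M Y (tail_process n U) X"
  shows "AE \<omega> in M. nn_cond_exp M (past_algebra M Y n) (\<lambda>\<omega>. ennreal ((X \<omega>)\<^sup>2)) \<omega>
    = nn_cond_exp M (past_algebra M Y n) (sq_norm (tail_process n U)) \<omega>"
proof -
  have [measurable]: "X \<in> borel_measurable M" using X by (simp add: is_stochastic_integral_def)
  have UM: "UNIV \<inter> space M \<in> sets (past_algebra M Y n)"
    using sets.top[of "past_algebra M Y n"] by simp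
  have [measurable]: "sq_norm (tail_process n U) \<in> borel_measurable M"
    by (rule measurable_sq_norm)
       (use predictable_measurable[OF predictable_restricted_tail[OF U(1) UM]] in \<open>simp add: restricted_tail_UNIV\<close>)
  have "AE \<omega> in M. nn_cond_exp M (past_algebra M Y n) (sq_norm (tail_process n U)) \<omega>
      = nn_cond_exp M (past_algebra M Y n) (\<lambda>\<omega>. ennreal ((X \<omega>)\<^sup>2)) \<omega>"
  proof (rule past.nn_cond_exp_charact)
    fix A assume A: "A \<in> sets (past_algebra M Y n)"
    have "(\<integral>\<^sup>+\<omega>\<in>A. ennreal ((X \<omega>)\<^sup>2) \<partial>M) = (\<integral>\<^sup>+\<omega>. indicator A \<omega> * sq_norm (tail_process n U) \<omega> \<partial>M)"
      using restricted_isometry[OF U X A] by (simp add: mult.commute)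
    also have "\<dots> = (\<integral>\<^sup>+\<omega>. indicator A \<omega> * nn_cond_exp M (past_algebra M Y n) (sq_norm (tail_process n U)) \<omega> \<partial>M)"
      by (rule past.nn_cond_exp_intg[symmetric]) (use A in simp_all)
    finally show "(\<integral>\<^sup>+\<omega>\<in>A. ennreal ((X \<omega>)\<^sup>2) \<partial>M)
        = (\<integral>\<^sup>+\<omega>\<in>A. nn_cond_exp M (past_algebra M Y n) (sq_norm (tail_process n U)) \<omega> \<partial>M)"
      by (simp add: mult.commute)
  qed simp_all
  then show ?thesis by eventually_elim simp
qed

lemma square_integrable_tail_process:
  assumes "square_integrable M U"
  shows "square_integrable M (tail_process n U)"
proof -
  have "sq_norm (tail_process n U) \<omega> \<le> sq_norm U \<omega>" for \<omega>
    unfolding sq_norm_def by (intro suminf_le summableI) (simp add: tail_process_def)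
  then have "(\<integral>\<^sup>+\<omega>. sq_norm (tail_process n U) \<omega> \<partial>M) \<le> (\<integral>\<^sup>+\<omega>. sq_norm U \<omega> \<partial>M)"
    by (intro nn_integral_mono)
  then show ?thesis using assms by (simp add: square_integrable_def)
qed

lemma predictable_tail_process:
  assumes "predictable M Y U"
  shows "predictable M Y (tail_process n U)"
  using predictable_restricted_tail[OF assms, of UNIV n] sets.top[of "past_algebra M Y n"]
  by (simp add: restricted_tail_UNIV)

end

theorem proposition2p3:
  fixes M :: "'a measure"
    and Y :: "nat \<Rightarrow> 'a \<Rightarrow> real ^ 'd"
    and U :: "nat \<Rightarrow> 'a \<Rightarrow> real ^ 'd"
  assumes "prob_space M"
    and "\<And>n. Y n \<in> borel_measurable M"
    and "\<And>n. integrable M (\<lambda>\<omega>. (norm (Y n \<omega>))\<^sup>2)"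
    and "\<And>n i. AE \<omega> in M. real_cond_exp M (past_algebra M Y n) (\<lambda>\<omega>. Y n \<omega> $ i) \<omega> = 0"
    and "\<And>n i j. AE \<omega> in M.
           real_cond_exp M (past_algebra M Y n) (\<lambda>\<omega>. Y n \<omega> $ i * Y n \<omega> $ j) \<omega>
             = (if i = j then 1 else 0)"
    and "predictable M Y U"
    and "square_integrable M U"
  shows "is_stochastic_integral M Y U (stochastic_integral M Y U)
    \<and> (\<forall>V. approximates M Y V U \<longrightarrow>
          L2_converges M (\<lambda>k. elementary_integral Y (V k)) (stochastic_integral M Y U))
    \<and> (elementary_predictable M Y U \<longrightarrow>
          (AE \<omega> in M. stochastic_integral M Y U \<omega> = elementary_integral Y U \<omega>))
    \<and> (\<forall>n. AE \<omega> in M.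
          nn_cond_exp M (past_algebra M Y n)
            (\<lambda>\<omega>. ennreal (\<bar>stochastic_integral M Y (tail_process n U) \<omega>\<bar>\<^sup>2)) \<omega>
          = nn_cond_exp M (past_algebra M Y n) (sq_norm (tail_process n U)) \<omega>)"
proof -
  interpret normalized_noise M Y
    using assms(1-5) by (intro normalized_noise.intro normalized_noise_axioms.intro)
  note U = assms(6,7)
  note int = is_stochastic_integral_stochastic_integral[OF U]
  have "is_stochastic_integral M Y (tail_process n U) (stochastic_integral M Y (tail_process n U))" for n
    by (rule is_stochastic_integral_stochastic_integral[OF predictable_tail_process[OF U(1)]
        square_integrable_tail_process[OF U(2)]])
  then show ?thesis
    using int is_stochastic_integral_approximates[OF int U(1)]
      is_stochastic_integral_elementary[OF int] conditional_isometry[OF U]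
    by simp
qed

end
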